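(* Let $(S,M)$ be an unpunctured marked surface with a triangulation $\Gamma$, let $\gamma$ be an internal arc in $(S,M)$ not belonging to $\Gamma$, let $w$ be its string, $M(w)$ the corresponding string module and $CS(M(w))$ the set of canonical submodules of $M(w)$, each identified with its index set. Then there exists a map $v_\gamma:CS(M(w))\rightarrow \mathbb{Z}$ such that (1) $v_\gamma(0)=0$; (2) if two canonical submodules $N$ and $N'$ satisfy $N=N'\cup\{x_j\}$ for some index $j$ (that is, the index set of $N$ is the disjoint union of that of $N'$ and $\{j\}$), then $$v_\gamma(N)-v_\gamma(N')=\Omega'(x_j,N).$$
   Context: **Surface.** $S$ is a compact connected oriented surface with boundary, $M\subset\partial S$ is a finite set of marked points meeting every boundary component (no punctures). An arc is a curve in $S$, up to homotopy, with endpoints in $M$, not crossing itself (its endpoints may coincide), meeting $\partial S$ only at its endpoints, and not contractible to a point of $M$. It is a boundary arc if it cuts out a digon (it is homotopic to a boundary segment meeting $M$ only in its endpoints), otherwise internal. A triangulation $\Gamma$ is a maximal collection of arcs pairwise non-crossing in the interior of $S$ (it contains the boundary arcs); $(S,M)$ is assumed to admit one. **Quiver and algebra.** $Q=Q(\Gamma)$ has the internal arcs of $\Gamma$ as vertices. For every triangle $T$ of $\Gamma$ and two internal sides $a,b$ of $T$, there is an arrow $a\to b$ (said to lie in $T$) if $b$ is the predecessor of $a$ with respect to the clockwise orientation at the joint vertex of $a$ and $b$ in $T$, i.e. rotating $b$ clockwise about this vertex through $T$ gives $a$. $A(\Gamma)$ is the Jacobian algebra of $Q$ with potential the sum of the oriented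 3-cycles given by the triangles all of whose sides are internal; it is a gentle algebra over an algebraically closed field $K$. **String of $\gamma$.** Orient $\gamma$ and let $x_1,\dots,x_s$ ($s\ge 1$) be the internal arcs of $\Gamma$ crossed by $\gamma$, in order and with repetitions. Let $\Delta_0,\Delta_1,\dots,\Delta_s$ be the successive triangles traversed, so $\Delta_{i-1},\Delta_i$ are the triangles on the two sides of the $i$-th crossing. The string $w$ is $x_1 \overset{a_1}{-}x_2\overset{a_2}{-}\cdots\overset{a_{s-1}}{-}x_s$, where the letter $a_i$ is given by the arrow of $Q$ in $\Delta_i$ between $x_i$ and $x_{i+1}$; $a_i$ is called direct if the arrow is $x_i\to x_{i+1}$ and inverse if it is $x_i\leftarrow x_{i+1}$. **Modules.** $M(w)$ has a $K$-basis $z_1,\dots,z_s$, with $z_i$ at the vertex $x_i$; the arrow underlying $a_i$ sends $z_i\mapsto z_{i+1}$ if $a_i$ is direct, $z_{i+1}\mapsto z_i$ if $a_i$ is inverse, and all other actions of arrows are zero. A canonical submodule is a submodule spanned by a subset of $\{z_1,\dots,z_s\}$; it is identified with its index set $P\subseteq\{1,\dots,s\}$. The zero submodule has index set $\emptyset$. **Counting functions.** Let $P$ be (the index set of) a canonical submodule. - For $1\le i\le s-1$: if $a_i$ is inverse, $n^+(x_i,i,P)=1$ if $i+1\in P$ and $0$ otherwise; if $a_i$ is direct, $n^+(x_i,i,P)=0$ if $i+1\in P$ and $1$ otherwise. Set $n^+(x_s,s,P)=0$. - For $2\le i\le s$: if $a_{i-1}$ is inverse, $n^-(x_i,i,P)=0$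 if $i-1\in P$ and $1$ otherwise; if $a_{i-1}$ is direct, $n^-(x_i,i,P)=1$ if $i-1\in P$ and $0$ otherwise. Set $n^-(x_1,1,P)=0$. - For an internal arc $\tau\in\Gamma$ and $1\le i\le s$, $n(\tau,i,P)$ is the sum of the following contributions: (A) if $x_i=\tau$: $n^+(\tau,i,P)+n^-(\tau,i,P)$; (B) if $i\le s-1$ and $\tau$ is the third side of $\Delta_i$ (the other two being $x_i,x_{i+1}$): $1$ if exactly one of $i,i+1$ belongs to $P$, and $0$ otherwise; (C) if $i=1$ and $\tau\ne x_1$ is a side of $\Delta_0$: when the arrow in $\Delta_0$ between them is $\tau\to x_1$, the contribution is $0$ if $1\in P$ and $1$ if $1\notin P$; when it is $x_1\to\tau$, it is $1$ if $1\in P$ and $0$ if $1\notin P$; (D) if $i=s$ and $\tau\ne x_s$ is a side of $\Delta_s$: when the arrow in $\Delta_s$ between them is $\tau\to x_s$, the contribution is $0$ if $s\in P$ and $1$ if $s\notin P$; when it is $x_s\to\tau$, it is $1$ if $s\in P$ and $0$ if $s\notin P$. For $1\le j\le s$ and $\tau=x_j$ put $M^+(\tau,j,w)=\#\{i>j: x_i=\tau\}$, $M^-(\tau,j,w)=\#\{i<j: x_i=\tau\}$, $N^+(\tau,j,P)=n^+(\tau,j,P)+\sum_{i>j}n(\tau,i,P)$, $N^-(\tau,j,P)=n^-(\tau,j,P)+\sum_{i<j}n(\tau,i,P)$. Finally, if $j\in P$, $$\Omega'(x_j,P)=N^+(x_j,j,P)-M^+(x_j,j,w)-N^-(x_j,j,P)+M^-(x_j,j,w),$$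 and if $j\notin P$, $\Omega'(x_j,P)$ is the negative of this expression. *)

theory Defs
  imports "HOL-Complex_Analysis.Complex_Analysis"
begin

section \<open>Marked surfaces\<close>

text \<open>
  A marked surface is a subset of a Hausdorff space together with an oriented atlas and a set of
  marked points.  A chart is a pair (U, phi), where phi maps the relatively open set U
  homeomorphically onto a relatively open subset of the closed upper half plane, which carries
  the standard (counterclockwise) orientation of the complex plane.
\<close>

record 'a msurface =
  pts :: "'a set"
  atlas :: "('a set \<times> ('a \<Rightarrow> complex)) set"
  marks :: "'a set"

definition half_plane :: "complex set" where
  "half_plane = {z. 0 \<le> Im z}"

definition is_chart :: "'a::topological_space set \<Rightarrow> 'a set \<Rightarrow> ('a \<Rightarrow> complex) \<Rightarrow> bool" where
  "is_chart S U \<phi> \<longleftrightarrow>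
     openin (top_of_set S) U \<and> openin (top_of_set half_plane) (\<phi> ` U) \<and>
     (\<exists>\<psi>. homeomorphism U (\<phi> ` U) \<phi> \<psi>)"

text \<open>
  A locally injective continuous map of the plane preserves the orientation at z iff it maps small
  counterclockwise circles around z to curves winding once counterclockwise around the image of z.
\<close>

definition orient_pres_at :: "(complex \<Rightarrow> complex) \<Rightarrow> complex \<Rightarrow> bool" where
  "orient_pres_at h z \<longleftrightarrow>
     (\<forall>\<^sub>F r in at_right 0. winding_number (h \<circ> circlepath z r) (h z) = 1)"

definition oriented_surface :: "'a::t2_space msurface \<Rightarrow> bool" where
  "oriented_surface X \<longleftrightarrow>
     compact (pts X) \<and> connected (pts X) \<and> pts X \<noteq> {} \<and>
     (\<forall>(U, \<phi>) \<in> atlas X. is_chart (pts X) U \<phi>) \<and>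
     (\<Union>(U, \<phi>) \<in> atlas X. U) = pts X \<and>
     (\<forall>(U, \<phi>) \<in> atlas X. \<forall>(V, \<psi>) \<in> atlas X. \<forall>p \<in> U \<inter> V.
        0 < Im (\<phi> p) \<longrightarrow> orient_pres_at (\<psi> \<circ> inv_into U \<phi>) (\<phi> p))"

definition bd :: "'a msurface \<Rightarrow> 'a set" where
  "bd X = {p. \<exists>(U, \<phi>) \<in> atlas X. p \<in> U \<and> Im (\<phi> p) = 0}"

text \<open>Unpunctured: all marked points lie on the boundary.\<close>

definition marked_surface :: "'a::t2_space msurface \<Rightarrow> bool" where
  "marked_surface X \<longleftrightarrow>
     oriented_surface X \<and> bd X \<noteq> {} \<and>
     finite (marks X) \<and> marks X \<subseteq> bd X \<and>
     (\<forall>C \<in> components (bd X). C \<inter> marks X \<noteq> {})"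

section \<open>Arcs\<close>

text \<open>
  An arc is represented by a parametrised curve.  Two curves represent the same arc (equality of
  arcs) iff they are homotopic relative to their end points, up to reversal.
\<close>

definition path_interior :: "(real \<Rightarrow> 'a) \<Rightarrow> 'a set" where
  "path_interior p = p ` {0<..<1}"

definition same_arc :: "'a::t2_space msurface \<Rightarrow> (real \<Rightarrow> 'a) \<Rightarrow> (real \<Rightarrow> 'a) \<Rightarrow> bool" where
  "same_arc X p q \<longleftrightarrow>
     homotopic_paths (pts X) p q \<or> homotopic_paths (pts X) p (reversepath q)"

text \<open>
  Since the simple path p may be closed, its end points may coincide.
\<close>

definition marked_arc :: "'a::t2_space msurface \<Rightarrow> (real \<Rightarrow> 'a) \<Rightarrow> bool" where
  "marked_arc X p \<longleftrightarrow>
     simple_path p \<and> path_image p \<subseteq> pts X \<and>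
     pathstart p \<in> marks X \<and> pathfinish p \<in> marks X \<and>
     path_interior p \<inter> bd X = {} \<and>
     \<not> homotopic_paths (pts X) p (\<lambda>_. pathstart p)"

definition boundary_segment :: "'a::t2_space msurface \<Rightarrow> (real \<Rightarrow> 'a) \<Rightarrow> bool" where
  "boundary_segment X b \<longleftrightarrow>
     simple_path b \<and> path_image b \<subseteq> bd X \<and>
     pathstart b \<in> marks X \<and> pathfinish b \<in> marks X \<and> path_interior b \<inter> marks X = {}"

definition boundary_arc :: "'a::t2_space msurface \<Rightarrow> (real \<Rightarrow> 'a) \<Rightarrow> bool" where
  "boundary_arc X p \<longleftrightarrow> marked_arc X p \<and> (\<exists>b. boundary_segment X b \<and> same_arc X p b)"

definition internal_arc :: "'a::t2_space msurface \<Rightarrow> (real \<Rightarrow> 'a) \<Rightarrow> bool" where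
  "internal_arc X p \<longleftrightarrow> marked_arc X p \<and> \<not> boundary_arc X p"

definition noncrossing :: "'a::t2_space msurface \<Rightarrow> (real \<Rightarrow> 'a) \<Rightarrow> (real \<Rightarrow> 'a) \<Rightarrow> bool" where
  "noncrossing X p q \<longleftrightarrow>
     (\<exists>p' q'. marked_arc X p' \<and> same_arc X p' p \<and> marked_arc X q' \<and> same_arc X q' q \<and>
              path_interior p' \<inter> path_interior q' = {})"

section \<open>Triangulations and triangles\<close>

text \<open>
  A triangulation is given by a system of curves with pairwise disjoint interiors, exactly one for
  each member of a maximal collection of pairwise non-crossing arcs; within it, equality of arcs is
  equality of curves.  Boundary arcs are drawn, like all arcs, with interior away from the boundary
  of the surface.
\<close>

definition marked_triangulation :: "'a::t2_space msurface \<Rightarrow> (real \<Rightarrow> 'a) set \<Rightarrow> bool" where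
  "marked_triangulation X \<Gamma> \<longleftrightarrow>
     (\<forall>p \<in> \<Gamma>. marked_arc X p) \<and>
     (\<forall>p \<in> \<Gamma>. \<forall>q \<in> \<Gamma>. p \<noteq> q \<longrightarrow> \<not> same_arc X p q \<and> path_interior p \<inter> path_interior q = {}) \<and>
     (\<forall>q. marked_arc X q \<and> (\<forall>p \<in> \<Gamma>. noncrossing X p q) \<longrightarrow> (\<exists>p \<in> \<Gamma>. same_arc X p q))"

definition drawing :: "(real \<Rightarrow> 'a::t2_space) set \<Rightarrow> 'a set" where
  "drawing \<Gamma> = (\<Union>p \<in> \<Gamma>. path_image p)"

text \<open>The model triangle; its vertices 0, 1, i are listed counterclockwise.\<close>

definition model_triangle :: "complex set" where
  "model_triangle = convex hull {0, 1, \<i>}"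

definition traverses :: "(real \<Rightarrow> 'a) \<Rightarrow> (real \<Rightarrow> 'a) \<Rightarrow> bool" where
  "traverses g p \<longleftrightarrow> (\<forall>t \<in> {0..1}. g t = p t) \<or> (\<forall>t \<in> {0..1}. g t = p (1 - t))"

text \<open>
  A characteristic map f of the region T: an orientation preserving parametrisation of T by the open
  model triangle, whose extension to the closed triangle runs through the arcs a, b, c of the
  triangulation along the successive sides, taken counterclockwise.  Vertices may be identified by f.
  The three sides are distinct because there are no punctures, hence no self-folded triangles.
\<close>

definition triangle_map ::
  "'a::t2_space msurface \<Rightarrow> (real \<Rightarrow> 'a) set \<Rightarrow> 'a set \<Rightarrow> (complex \<Rightarrow> 'a) \<Rightarrow>
   (real \<Rightarrow> 'a) \<times> (real \<Rightarrow> 'a) \<times> (real \<Rightarrow> 'a) \<Rightarrow> bool" where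
  "triangle_map X \<Gamma> T f = (\<lambda>(a, b, c).
     continuous_on model_triangle f \<and>
     inj_on f (interior model_triangle) \<and> f ` interior model_triangle = T \<and>
     (\<forall>z \<in> interior model_triangle. \<forall>(U, \<phi>) \<in> atlas X. f z \<in> U \<longrightarrow> orient_pres_at (\<phi> \<circ> f) z) \<and>
     {a, b, c} \<subseteq> \<Gamma> \<and> distinct [a, b, c] \<and>
     traverses (f \<circ> linepath 0 1) a \<and>
     traverses (f \<circ> linepath 1 \<i>) b \<and>
     traverses (f \<circ> linepath \<i> 0) c)"

definition triangle :: "'a::t2_space msurface \<Rightarrow> (real \<Rightarrow> 'a) set \<Rightarrow> 'a set \<Rightarrow> bool" where
  "triangle X \<Gamma> T \<longleftrightarrow>
     T \<in> components (pts X - drawing \<Gamma>) \<and> (\<exists>f abc. triangle_map X \<Gamma> T f abc)"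

text \<open>
  The sides of T in counterclockwise order.  The triple depends on the characteristic map only up to
  a cyclic rotation, which is immaterial in all uses below.
\<close>

definition ccw_sides ::
  "'a::t2_space msurface \<Rightarrow> (real \<Rightarrow> 'a) set \<Rightarrow> 'a set \<Rightarrow>
   (real \<Rightarrow> 'a) \<times> (real \<Rightarrow> 'a) \<times> (real \<Rightarrow> 'a)" where
  "ccw_sides X \<Gamma> T = (SOME abc. \<exists>f. triangle_map X \<Gamma> T f abc)"

definition sides ::
  "'a::t2_space msurface \<Rightarrow> (real \<Rightarrow> 'a) set \<Rightarrow> 'a set \<Rightarrow> (real \<Rightarrow> 'a) set" where
  "sides X \<Gamma> T = (case ccw_sides X \<Gamma> T of (a, b, c) \<Rightarrow> {a, b, c})"

section \<open>The quiver\<close>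

definition quiver_vertices :: "'a::t2_space msurface \<Rightarrow> (real \<Rightarrow> 'a) set \<Rightarrow> (real \<Rightarrow> 'a) set" where
  "quiver_vertices X \<Gamma> = {p \<in> \<Gamma>. internal_arc X p}"

text \<open>
  The arrows p \<open>\<rightarrow>\<close> q lying in T.  If a, b, c are the sides in counterclockwise order, then rotating a
  clockwise through T about the common vertex of a and b gives b, so that the arrow is b \<open>\<rightarrow>\<close> a, and
  similarly for the other two pairs.
\<close>

definition arrow ::
  "'a::t2_space msurface \<Rightarrow> (real \<Rightarrow> 'a) set \<Rightarrow> 'a set \<Rightarrow> (real \<Rightarrow> 'a) \<Rightarrow> (real \<Rightarrow> 'a) \<Rightarrow> bool" where
  "arrow X \<Gamma> T p q \<longleftrightarrow>
     triangle X \<Gamma> T \<and> p \<in> quiver_vertices X \<Gamma> \<and> q \<in> quiver_vertices X \<Gamma> \<and>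
     (case ccw_sides X \<Gamma> T of (a, b, c) \<Rightarrow> (p, q) \<in> {(b, a), (c, b), (a, c)})"

text \<open>An arrow is a triple (T, source, target), so parallel arrows in different triangles differ.\<close>

definition quiver_arrows ::
  "'a::t2_space msurface \<Rightarrow> (real \<Rightarrow> 'a) set \<Rightarrow> ('a set \<times> (real \<Rightarrow> 'a) \<times> (real \<Rightarrow> 'a)) set" where
  "quiver_arrows X \<Gamma> = {(T, p, q). arrow X \<Gamma> T p q}"

section \<open>The string of an arc\<close>

text \<open>
  The string has the vertices \<open>sarc w 1, ..., sarc w (slen w)\<close>, the letters
  \<open>sdirect w 1, ..., sdirect w (slen w - 1)\<close> (true for direct letters), and runs through the
  triangles \<open>stri w 0, ..., stri w (slen w)\<close>.  Other arguments are irrelevant.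
\<close>

record 'a string_data =
  slen :: nat
  sarc :: "nat \<Rightarrow> (real \<Rightarrow> 'a)"
  stri :: "nat \<Rightarrow> 'a set"
  sdirect :: "nat \<Rightarrow> bool"

definition crossing_times :: "(real \<Rightarrow> 'a::t2_space) set \<Rightarrow> (real \<Rightarrow> 'a) \<Rightarrow> real set" where
  "crossing_times \<Gamma> c = {t. 0 < t \<and> t < 1 \<and> c t \<in> drawing \<Gamma>}"

text \<open>
  The crossings are read off from a representative c of the arc that crosses the drawing as few times
  as possible.  As \<^const>\<open>same_arc\<close> allows reversal, c may have either orientation.  Because no
  triangle is self-folded, the triangles on the two sides of a crossing are distinct.
\<close>

definition string_of ::
  "'a::t2_space msurface \<Rightarrow> (real \<Rightarrow> 'a) set \<Rightarrow> (real \<Rightarrow> 'a) \<Rightarrow> 'a string_data \<Rightarrow> bool" where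
  "string_of X \<Gamma> \<gamma> w \<longleftrightarrow>
     slen w \<ge> 1 \<and>
     (\<exists>c t. marked_arc X c \<and> same_arc X c \<gamma> \<and>
        (\<forall>c'. marked_arc X c' \<and> same_arc X c' \<gamma> \<and> finite (crossing_times \<Gamma> c') \<longrightarrow>
              slen w \<le> card (crossing_times \<Gamma> c')) \<and>
        t 0 = 0 \<and> t (slen w + 1) = 1 \<and> (\<forall>i \<le> slen w. t i < t (i + 1)) \<and>
        (\<forall>i \<in> {1..slen w}. c (t i) \<in> path_interior (sarc w i)) \<and>
        (\<forall>i \<le> slen w. c ` {t i<..<t (i + 1)} \<subseteq> stri w i)) \<and>
     (\<forall>i \<in> {1..slen w}. sarc w i \<in> quiver_vertices X \<Gamma>) \<and>
     (\<forall>i \<le> slen w. triangle X \<Gamma> (stri w i)) \<and>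
     (\<forall>i \<in> {1..slen w}. stri w (i - 1) \<noteq> stri w i \<and>
        sarc w i \<in> sides X \<Gamma> (stri w (i - 1)) \<and> sarc w i \<in> sides X \<Gamma> (stri w i)) \<and>
     (\<forall>i \<in> {1..<slen w}.
        (sdirect w i \<longrightarrow> arrow X \<Gamma> (stri w i) (sarc w i) (sarc w (i + 1))) \<and>
        (\<not> sdirect w i \<longrightarrow> arrow X \<Gamma> (stri w i) (sarc w (i + 1)) (sarc w i)))"

section \<open>The string module\<close>

text \<open>
  The string module is the representation of the quiver with underlying space the functions from
  \<open>{1..slen w}\<close> to K (extended by 0); \<open>zvec i\<close> is its i-th basis vector.  The algebra is a quotient
  of the path algebra, so a subspace is a submodule iff it is stable under the trivial paths and the
  arrows of the quiver.
\<close>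

definition letter_arrow :: "'a string_data \<Rightarrow> nat \<Rightarrow> 'a set \<times> (real \<Rightarrow> 'a) \<times> (real \<Rightarrow> 'a)" where
  "letter_arrow w i =
     (if sdirect w i then (stri w i, sarc w i, sarc w (i + 1))
      else (stri w i, sarc w (i + 1), sarc w i))"

definition string_module :: "'a string_data \<Rightarrow> (nat \<Rightarrow> 'k::field) set" where
  "string_module w = {m. \<forall>i. i \<notin> {1..slen w} \<longrightarrow> m i = 0}"

definition zvec :: "nat \<Rightarrow> nat \<Rightarrow> 'k::field" where
  "zvec i = (\<lambda>k. if k = i then 1 else 0)"

definition vertex_act ::
  "'a string_data \<Rightarrow> (real \<Rightarrow> 'a) \<Rightarrow> (nat \<Rightarrow> 'k::field) \<Rightarrow> nat \<Rightarrow> 'k" where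
  "vertex_act w p m = (\<lambda>k. if k \<in> {1..slen w} \<and> sarc w k = p then m k else 0)"

definition arrow_act ::
  "'a string_data \<Rightarrow> 'a set \<times> (real \<Rightarrow> 'a) \<times> (real \<Rightarrow> 'a) \<Rightarrow> (nat \<Rightarrow> 'k::field) \<Rightarrow> nat \<Rightarrow> 'k" where
  "arrow_act w \<alpha> m = (\<lambda>k.
     (\<Sum>i \<in> {i \<in> {1..<slen w}. letter_arrow w i = \<alpha>}.
        if sdirect w i then m i * zvec (i + 1) k else m (i + 1) * zvec i k))"

definition submodule ::
  "'a::t2_space msurface \<Rightarrow> (real \<Rightarrow> 'a) set \<Rightarrow> 'a string_data \<Rightarrow> (nat \<Rightarrow> 'k::field) set \<Rightarrow> bool" where
  "submodule X \<Gamma> w N \<longleftrightarrow>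
     N \<subseteq> string_module w \<and> (\<lambda>_. 0) \<in> N \<and>
     (\<forall>m \<in> N. \<forall>m' \<in> N. (\<lambda>k. m k + m' k) \<in> N) \<and>
     (\<forall>c. \<forall>m \<in> N. (\<lambda>k. c * m k) \<in> N) \<and>
     (\<forall>p \<in> quiver_vertices X \<Gamma>. \<forall>m \<in> N. vertex_act w p m \<in> N) \<and>
     (\<forall>\<alpha> \<in> quiver_arrows X \<Gamma>. \<forall>m \<in> N. arrow_act w \<alpha> m \<in> N)"

definition zspan :: "nat set \<Rightarrow> (nat \<Rightarrow> 'k::field) set" where
  "zspan P = {m. \<exists>c. m = (\<lambda>k. \<Sum>i \<in> P. c i * zvec i k)}"

definition canonical_submodules ::
  "'a::t2_space msurface \<Rightarrow> (real \<Rightarrow> 'a) set \<Rightarrow> 'a string_data \<Rightarrow> (nat \<Rightarrow> 'k::field) set set" where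
  "canonical_submodules X \<Gamma> w = {N. submodule X \<Gamma> w N \<and> (\<exists>P \<subseteq> {1..slen w}. N = zspan P)}"

definition index_set :: "'a string_data \<Rightarrow> (nat \<Rightarrow> 'k::field) set \<Rightarrow> nat set" where
  "index_set w N = {i \<in> {1..slen w}. zvec i \<in> N}"

section \<open>The counting functions\<close>

text \<open>
  The values \<open>n\<^sup>+(x\<^sub>i, i, P)\<close> and \<open>n\<^sup>-(x\<^sub>i, i, P)\<close>; the first argument is determined by i.
\<close>

definition nplus :: "'a string_data \<Rightarrow> nat \<Rightarrow> nat set \<Rightarrow> int" where
  "nplus w i P =
     (if i < slen w
      then (if sdirect w i then (if i + 1 \<in> P then 0 else 1) else (if i + 1 \<in> P then 1 else 0))
      else 0)"

definition nminus :: "'a string_data \<Rightarrow> nat \<Rightarrow> nat set \<Rightarrow> int" where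
  "nminus w i P =
     (if 2 \<le> i
      then (if sdirect w (i - 1) then (if i - 1 \<in> P then 1 else 0)
            else (if i - 1 \<in> P then 0 else 1))
      else 0)"

text \<open>
  The contribution of an end triangle T of the string to the arc p, where i is the index of the
  first or last crossing.
\<close>

definition end_contrib ::
  "'a::t2_space msurface \<Rightarrow> (real \<Rightarrow> 'a) set \<Rightarrow> 'a string_data \<Rightarrow> 'a set \<Rightarrow>
   (real \<Rightarrow> 'a) \<Rightarrow> nat \<Rightarrow> nat set \<Rightarrow> int" where
  "end_contrib X \<Gamma> w T p i P =
     (if p \<noteq> sarc w i \<and> p \<in> sides X \<Gamma> T
      then (if arrow X \<Gamma> T p (sarc w i) then (if i \<in> P then 0 else 1)
            else if arrow X \<Gamma> T (sarc w i) p then (if i \<in> P then 1 else 0)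
            else 0)
      else 0)"

definition ncount ::
  "'a::t2_space msurface \<Rightarrow> (real \<Rightarrow> 'a) set \<Rightarrow> 'a string_data \<Rightarrow>
   (real \<Rightarrow> 'a) \<Rightarrow> nat \<Rightarrow> nat set \<Rightarrow> int" where
  "ncount X \<Gamma> w p i P =
     (if sarc w i = p then nplus w i P + nminus w i P else 0) +
     (if i < slen w \<and> p \<in> sides X \<Gamma> (stri w i) - {sarc w i, sarc w (i + 1)}
      then (if (i \<in> P) \<noteq> (i + 1 \<in> P) then 1 else 0) else 0) +
     (if i = 1 then end_contrib X \<Gamma> w (stri w 0) p i P else 0) +
     (if i = slen w then end_contrib X \<Gamma> w (stri w (slen w)) p i P else 0)"

definition Mplus :: "'a string_data \<Rightarrow> nat \<Rightarrow> int" where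
  "Mplus w j = int (card {i \<in> {1..slen w}. j < i \<and> sarc w i = sarc w j})"

definition Mminus :: "'a string_data \<Rightarrow> nat \<Rightarrow> int" where
  "Mminus w j = int (card {i \<in> {1..slen w}. i < j \<and> sarc w i = sarc w j})"

definition Nplus ::
  "'a::t2_space msurface \<Rightarrow> (real \<Rightarrow> 'a) set \<Rightarrow> 'a string_data \<Rightarrow> nat \<Rightarrow> nat set \<Rightarrow> int" where
  "Nplus X \<Gamma> w j P = nplus w j P + (\<Sum>i \<in> {j<..slen w}. ncount X \<Gamma> w (sarc w j) i P)"

definition Nminus ::
  "'a::t2_space msurface \<Rightarrow> (real \<Rightarrow> 'a) set \<Rightarrow> 'a string_data \<Rightarrow> nat \<Rightarrow> nat set \<Rightarrow> int" where
  "Nminus X \<Gamma> w j P = nminus w j P + (\<Sum>i \<in> {1..<j}. ncount X \<Gamma> w (sarc w j) i P)"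

definition Omega' ::
  "'a::t2_space msurface \<Rightarrow> (real \<Rightarrow> 'a) set \<Rightarrow> 'a string_data \<Rightarrow> nat \<Rightarrow> nat set \<Rightarrow> int" where
  "Omega' X \<Gamma> w j P =
     (let d = Nplus X \<Gamma> w j P - Mplus w j - Nminus X \<Gamma> w j P + Mminus w j
      in if j \<in> P then d else - d)"

end

theory Submission
  imports Defs
begin

text \<open>
  On index sets P of submodules, every count occurring in \<open>\<Omega>'(x\<^sub>j, P)\<close> is an affine function of the
  indicators of P.  For j in P the coefficient of the indicator of \<open>k \<noteq> j\<close> in \<open>\<Omega>'(x\<^sub>j, P)\<close> is
  \<open>sgn (k - j)\<close> times the signed number of arrows from \<open>x\<^sub>k\<close> to \<open>x\<^sub>j\<close>.  Being a product of two
  skew-symmetric factors it is symmetric in j and k, so \<open>\<Omega>'\<close> is the discrete gradient of a quadratic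
  function.  The skew symmetry of the second factor requires that the two triangles adjacent to a
  crossing of an arc are the only triangles having that arc as a side.
\<close>

section \<open>Triangles along an arc\<close>

text \<open>The barycentric coordinates of \<open>z\<close> with respect to 0, 1,
  \<open>\<i>\<close> are \<open>1 - Re z - Im z\<close>, \<open>Re z\<close>,
  \<open>Im z\<close>.\<close>

lemma model_triangle_iff: "z \<in> model_triangle \<longleftrightarrow> 0 \<le> Re z \<and> 0 \<le> Im z \<and> Re z + Im z \<le> 1"
proof
  assume "z \<in> model_triangle"
  then show "0 \<le> Re z \<and> 0 \<le> Im z \<and> Re z + Im z \<le> 1"
    by (auto simp: model_triangle_def convex_hull_3)
next
  assume "0 \<le> Re z \<and> 0 \<le> Im z \<and> Re z + Im z \<le> 1"
  then have "z = (1 - Re z - Im z) *\<^sub>R 0 + Re z *\<^sub>R 1 + Im z *\<^sub>R \<i> \<and>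
      0 \<le> 1 - Re z - Im z \<and> 0 \<le> Re z \<and> 0 \<le> Im z \<and> (1 - Re z - Im z) + Re z + Im z = 1"
    by (auto simp: complex_eq_iff)
  then show "z \<in> model_triangle"
    unfolding model_triangle_def convex_hull_3 by blast
qed

lemma interior_model_triangle_iff:
  "z \<in> interior model_triangle \<longleftrightarrow> 0 < Re z \<and> 0 < Im z \<and> Re z + Im z < 1"
proof
  assume z: "z \<in> interior model_triangle"
  then obtain e where e: "e > 0" "cball z e \<subseteq> model_triangle"
    by (auto simp: mem_interior_cball)
  \<comment> \<open>Moving by \<open>e\<close> to the left, down or to the right stays inside the
    triangle; each move makes one of the three inequalities strict.\<close>
  have "z - of_real e \<in> cball z e" "z - of_real e * \<i> \<in> cball z e" "z + of_real e \<in> cball z e"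
    using e(1) by (auto simp: dist_norm norm_mult)
  then have "z - of_real e \<in> model_triangle" "z - of_real e * \<i> \<in> model_triangle"
    "z + of_real e \<in> model_triangle"
    using e(2) by blast+
  then show "0 < Re z \<and> 0 < Im z \<and> Re z + Im z < 1"
    using e(1) by (auto simp: model_triangle_iff)
next
  let ?W = "{z. 0 < Re z} \<inter> {z. 0 < Im z} \<inter> {z. Re z + Im z < 1}"
  have "open ?W"
    by (intro open_Int open_Collect_less continuous_intros)
  moreover have "?W \<subseteq> model_triangle"
    by (auto simp: model_triangle_iff)
  ultimately have "?W \<subseteq> interior model_triangle"
    by (rule interior_maximal[rotated])
  moreover assume "0 < Re z \<and> 0 < Im z \<and> Re z + Im z < 1"
  ultimately show "z \<in> interior model_triangle"
    by blast
qed

definition vertex_orders :: "(complex \<times> complex \<times> complex) set" where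
  "vertex_orders = {(0, 1, \<i>), (0, \<i>, 1), (1, 0, \<i>), (1, \<i>, 0), (\<i>, 0, 1), (\<i>, 1, 0)}"

text \<open>The real affine map sending 0, 1, \<open>\<i>\<close> to \<open>u\<close>,
  \<open>v\<close>, \<open>w\<close>.\<close>

definition vertex_affine :: "complex \<Rightarrow> complex \<Rightarrow> complex \<Rightarrow> complex \<Rightarrow> complex" where
  "vertex_affine u v w z = (1 - Re z - Im z) *\<^sub>R u + Re z *\<^sub>R v + Im z *\<^sub>R w"

text \<open>Permuting the vertices only permutes the barycentric coordinates.\<close>

lemma vertex_affine_symmetry:
  assumes "(u, v, w) \<in> vertex_orders"
  shows "vertex_affine u v w ` model_triangle \<subseteq> model_triangle" (is ?A)
    and "vertex_affine u v w ` interior model_triangle \<subseteq> interior model_triangle" (is ?B)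
    and "inj (vertex_affine u v w)" (is ?C)
proof -
  consider "u = 0" "v = 1" "w = \<i>" | "u = 0" "v = \<i>" "w = 1" | "u = 1" "v = 0" "w = \<i>"
    | "u = 1" "v = \<i>" "w = 0" | "u = \<i>" "v = 0" "w = 1" | "u = \<i>" "v = 1" "w = 0"
    using assms unfolding vertex_orders_def by (elim insertE emptyE Pair_inject) simp_all
  then have "?A \<and> ?B \<and> ?C"
    by cases (auto simp: vertex_affine_def model_triangle_iff interior_model_triangle_iff inj_def
        complex_eq_iff)
  then show ?A ?B ?C
    by simp_all
qed

text \<open>Precomposing \<open>f\<close> with a symmetry of the model triangle moves the side
  \<open>p\<close> to the segment from 0 to 1, in its own parametrisation. This normal form allows
  characteristic maps of different triangles to be glued along \<open>p\<close>; the symmetry may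
  reverse the orientation.\<close>

lemma triangle_map_side:
  assumes f: "triangle_map X \<Gamma> T f (a, b, c)" and p: "p \<in> {a, b, c}"
  obtains h where "continuous_on model_triangle h" "inj_on h (interior model_triangle)"
    "h ` interior model_triangle \<subseteq> T" "\<And>t. t \<in> {0..1} \<Longrightarrow> h (of_real t) = p t"
proof -
  have f': "continuous_on model_triangle f" "inj_on f (interior model_triangle)"
      "f ` interior model_triangle = T" "traverses (f \<circ> linepath 0 1) a"
      "traverses (f \<circ> linepath 1 \<i>) b" "traverses (f \<circ> linepath \<i> 0) c"
    using f by (simp_all add: triangle_map_def)
  have ord: "(0, 1, \<i>) \<in> vertex_orders" "(1, \<i>, 0) \<in> vertex_orders" "(\<i>, 0, 1) \<in> vertex_orders"
    by (simp_all add: vertex_orders_def)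
  obtain u v w where uvw: "(u, v, w) \<in> vertex_orders" and tr: "traverses (f \<circ> linepath u v) p"
    using p f'(4-6) ord by (elim insertE emptyE) metis+
  obtain u v w where uvw: "(u, v, w) \<in> vertex_orders"
    and tr: "\<forall>t\<in>{0..1}. f (linepath u v t) = p t"
  proof (cases "\<forall>t\<in>{0..1}. f (linepath u v t) = p t")
    case True
    then show ?thesis
      by (rule that[OF uvw])
  next
    case False
    then have *: "\<forall>t\<in>{0..1}. f (linepath u v t) = p (1 - t)"
      using tr by (auto simp: traverses_def)
    \<comment> \<open>Exchanging \<open>u\<close> and \<open>v\<close> corrects a side that is run
      through backwards.\<close>
    have "\<forall>t\<in>{0..1}. f (linepath v u t) = p t"
    proof
      fix t :: real
      assume t: "t \<in> {0..1}"
      have "linepath v u t = linepath u v (1 - t)"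
        by (simp add: linepath_def)
      then show "f (linepath v u t) = p t"
        using bspec[OF *, of "1 - t"] t by simp
    qed
    moreover have "(v, u, w) \<in> vertex_orders"
      using uvw unfolding vertex_orders_def by (elim insertE emptyE Pair_inject) simp_all
    ultimately show ?thesis
      by (rule that[rotated])
  qed
  let ?A = "vertex_affine u v w"
  note A = vertex_affine_symmetry[OF uvw]
  show thesis
  proof (rule that)
    show "continuous_on model_triangle (f \<circ> ?A)"
    proof (rule continuous_on_compose)
      show "continuous_on model_triangle ?A"
        unfolding vertex_affine_def by (intro continuous_intros)
      show "continuous_on (?A ` model_triangle) f"
        using f'(1) A(1) by (rule continuous_on_subset)
    qed
    show "inj_on (f \<circ> ?A) (interior model_triangle)"
      using A(2,3) f'(2) by (intro comp_inj_on) (auto intro: inj_on_subset)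
    show "(f \<circ> ?A) ` interior model_triangle \<subseteq> T"
      using A(2) f'(3) by auto
    show "(f \<circ> ?A) (of_real t) = p t" if "t \<in> {0..1}" for t
      using bspec[OF tr that] by (simp add: vertex_affine_def linepath_def)
  qed
qed

text \<open>A triangle has a characteristic map by definition, so the choice made in
  \<open>ccw_sides\<close> is a genuine triple of sides.\<close>

lemma triangle_map_ccw_sides:
  assumes "triangle X \<Gamma> T"
  obtains f where "triangle_map X \<Gamma> T f (ccw_sides X \<Gamma> T)"
proof -
  have "\<exists>abc f. triangle_map X \<Gamma> T f abc"
    using assms unfolding triangle_def by (elim conjE exE) (intro exI)
  then have "\<exists>f. triangle_map X \<Gamma> T f (ccw_sides X \<Gamma> T)"
    unfolding ccw_sides_def by (rule someI_ex)
  then show thesis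
    by (elim exE) (rule that)
qed

text \<open>
  Two characteristic maps, glued along p, form a continuous injective map of a disc.  By invariance
  of domain its image is a neighbourhood of the midpoint of p, hence it meets every triangle with
  side p.
\<close>

lemma at_most_two_triangles:
  assumes X: "oriented_surface X"
    and p: "p \<in> \<Gamma>" "simple_path p" "path_image p \<subseteq> pts X"
    and T: "triangle X \<Gamma> T1" "triangle X \<Gamma> T2" "triangle X \<Gamma> T3"
    and sides: "p \<in> sides X \<Gamma> T1" "p \<in> sides X \<Gamma> T2" "p \<in> sides X \<Gamma> T3"
    and "T1 \<noteq> T2"
  shows "T3 = T1 \<or> T3 = T2"
proof (rule ccontr)
  assume *: "\<not> (T3 = T1 \<or> T3 = T2)"
  have comp: "T' \<in> components (pts X - drawing \<Gamma>)" if "triangle X \<Gamma> T'" for T'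
    using that by (simp add: triangle_def)
  have sub: "T' \<subseteq> pts X" "T' \<inter> path_image p = {}" if "triangle X \<Gamma> T'" for T'
    using in_components_subset[OF comp[OF that]] p(1) by (auto simp: drawing_def)
  have disj: "T1 \<inter> T2 = {}" "T1 \<inter> T3 = {}" "T2 \<inter> T3 = {}"
    using * \<open>T1 \<noteq> T2\<close> components_nonoverlap[OF comp comp] T by blast+
  have "\<exists>h. continuous_on model_triangle h \<and> inj_on h (interior model_triangle) \<and>
      h ` interior model_triangle \<subseteq> T' \<and> (\<forall>t\<in>{0..1}. h (of_real t) = p t)"
    if T': "triangle X \<Gamma> T'" and s: "p \<in> sides X \<Gamma> T'" for T'
  proof -
    obtain a b c where abc: "ccw_sides X \<Gamma> T' = (a, b, c)"
      by (cases "ccw_sides X \<Gamma> T'")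
    obtain f where "triangle_map X \<Gamma> T' f (a, b, c)"
      using triangle_map_ccw_sides[OF T'] abc by metis
    moreover have "p \<in> {a, b, c}"
      using s abc by (simp add: sides_def)
    ultimately show ?thesis
      by (rule triangle_map_side) blast
  qed
  note ex = this
  obtain h1 where h1: "continuous_on model_triangle h1" "inj_on h1 (interior model_triangle)"
      "h1 ` interior model_triangle \<subseteq> T1" "\<And>t. t \<in> {0..1} \<Longrightarrow> h1 (of_real t) = p t"
    using ex[OF T(1) sides(1)] by blast
  obtain h2 where h2: "continuous_on model_triangle h2" "inj_on h2 (interior model_triangle)"
      "h2 ` interior model_triangle \<subseteq> T2" "\<And>t. t \<in> {0..1} \<Longrightarrow> h2 (of_real t) = p t"
    using ex[OF T(2) sides(2)] by blast
  obtain h3 where h3: "continuous_on model_triangle h3"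
      "h3 ` interior model_triangle \<subseteq> T3" "\<And>t. t \<in> {0..1} \<Longrightarrow> h3 (of_real t) = p t"
    using ex[OF T(3) sides(3)] by blast
  \<comment> \<open>The upper half of the disc is mapped by \<open>h1\<close>, the lower half by the
    mirror image of \<open>h2\<close>; on the real axis both agree with \<open>p\<close>.\<close>
  define G where "G z = (if 0 \<le> Im z then h1 z else h2 (cnj z))" for z
  \<comment> \<open>The radius 1/4 keeps the upper half of \<open>B\<close> and the reflected lower
    half inside the model triangle.\<close>
  define B where "B = ball (1/2::complex) (1/4)"
  have B: "0 < Re z \<and> Re z < 1 \<and> Re z + Im z < 1 \<and> Re z - Im z < 1" if "z \<in> B" for z
  proof -
    have "\<bar>Re (z - 1/2)\<bar> < 1/4" "\<bar>Im (z - 1/2)\<bar> < 1/4"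
      using that abs_Re_le_cmod[of "z - 1/2"] abs_Im_le_cmod[of "z - 1/2"]
      by (auto simp: B_def dist_norm norm_minus_commute)
    then have "Re z - 1/2 < 1/4" "1/2 - Re z < 1/4" "Im z < 1/4" "- Im z < 1/4"
      unfolding abs_less_iff by auto
    then show ?thesis
      by linarith
  qed
  have G_pos: "G z = h1 z \<and> G z \<in> T1 \<and> z \<in> interior model_triangle" if "z \<in> B" "0 < Im z" for z
    using B[OF that(1)] that(2) h1(3) by (auto simp: G_def interior_model_triangle_iff)
  have G_neg: "G z = h2 (cnj z) \<and> G z \<in> T2 \<and> cnj z \<in> interior model_triangle"
    if "z \<in> B" "Im z < 0" for z
    using B[OF that(1)] that(2) h2(3) by (auto simp: G_def interior_model_triangle_iff)
  have G_zero: "G z = p (Re z) \<and> G z \<in> path_image p \<and> Re z \<in> {0<..<1}"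
    if "z \<in> B" "Im z = 0" for z
  proof -
    have "z = of_real (Re z)"
      using that(2) by (simp add: complex_eq_iff)
    then show ?thesis
      using B[OF that(1)] that(2) h1(4)[of "Re z"] by (auto simp: G_def path_image_def)
  qed
  have G_image: "G z \<in> T1 \<union> T2 \<union> path_image p" if "z \<in> B" for z
    using G_pos[OF that] G_neg[OF that] G_zero[OF that] by (cases "Im z" "0::real" rule: linorder_cases) auto
  \<comment> \<open>A simple path may be closed, so injectivity is available on the open interval;
    real points of \<open>B\<close> stay inside it.\<close>
  have inj_p: "inj_on p {0<..<1}"
    using p(2) by (fastforce simp: simple_path_def loop_free_def inj_on_def)
  have inj_G: "inj_on G B"
  proof (rule inj_onI)
    fix z z' assume z: "z \<in> B" "z' \<in> B" and eq: "G z = G z'"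
    note facts = G_pos[OF z(1)] G_neg[OF z(1)] G_zero[OF z(1)]
      G_pos[OF z(2)] G_neg[OF z(2)] G_zero[OF z(2)]
    \<comment> \<open>\<open>T1\<close>, \<open>T2\<close> and the image of \<open>p\<close> are
      pairwise disjoint, so equal values force equal signs of the imaginary parts.\<close>
    consider "0 < Im z" "0 < Im z'" | "Im z < 0" "Im z' < 0" | "Im z = 0" "Im z' = 0"
      using facts eq disj(1) sub(2)[OF T(1)] sub(2)[OF T(2)]
      by (metis disjoint_iff linorder_neqE)
    then show "z = z'"
    proof cases
      case 1
      then show ?thesis
        using facts eq h1(2) by (metis inj_onD)
    next
      case 2
      then show ?thesis
        using facts eq h2(2) by (metis inj_onD complex_cnj_cancel_iff)
    next
      case 3
      then show ?thesis
        using facts eq inj_p by (metis inj_onD complex_eqI)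
    qed
  qed
  have cont_G: "continuous_on B G"
  proof -
    have B_split: "{z \<in> B. 0 \<le> Im z} \<union> {z \<in> B. Im z \<le> 0} = B"
      by auto
    have closed: "closedin (top_of_set B) {z \<in> B. 0 \<le> Im z}" "closedin (top_of_set B) {z \<in> B. Im z \<le> 0}"
      using closedin_closed_Int[OF closed_halfspace_Im_ge, of B 0]
        closedin_closed_Int[OF closed_halfspace_Im_le, of B 0]
      by (simp_all add: Int_def conj_commute)
    have "continuous_on ({z \<in> B. 0 \<le> Im z} \<union> {z \<in> B. Im z \<le> 0}) G"
      unfolding G_def
    proof (rule continuous_on_cases_local)
      show "closedin (top_of_set ({z \<in> B. 0 \<le> Im z} \<union> {z \<in> B. Im z \<le> 0})) {z \<in> B. 0 \<le> Im z}"
        "closedin (top_of_set ({z \<in> B. 0 \<le> Im z} \<union> {z \<in> B. Im z \<le> 0})) {z \<in> B. Im z \<le> 0}"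
        unfolding B_split using closed .
      show "continuous_on {z \<in> B. 0 \<le> Im z} h1"
        using B by (auto intro!: continuous_on_subset[OF h1(1)] simp: model_triangle_iff less_imp_le)
      have "continuous_on {z \<in> B. Im z \<le> 0} (h2 \<circ> cnj)"
        using B by (intro continuous_on_compose continuous_intros continuous_on_subset[OF h2(1)])
          (auto simp: model_triangle_iff less_imp_le)
      then show "continuous_on {z \<in> B. Im z \<le> 0} (\<lambda>z. h2 (cnj z))"
        by (simp add: o_def)
      show "h1 z = h2 (cnj z)"
        if "z \<in> {z \<in> B. 0 \<le> Im z} \<and> \<not> 0 \<le> Im z \<or> z \<in> {z \<in> B. Im z \<le> 0} \<and> 0 \<le> Im z" for z
      proof -
        have z: "z \<in> B" "Im z = 0"
          using that by auto
        then have "z = of_real (Re z)" 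
          by (simp add: complex_eq_iff)
        moreover have "Re z \<in> {0..1}"
          using B[OF z(1)] by simp
        ultimately show ?thesis
          using h1(4) h2(4) by (metis complex_cnj_complex_of_real)
      qed
    qed
    then show ?thesis
      unfolding B_split .
  qed
  have half: "1/2 \<in> B" "G (1/2) = p (1/2)" "h3 (1/2) = p (1/2)"
    using G_zero[of "1/2"] h3(3)[of "1/2"] by (auto simp: B_def)
  have "p (1/2) \<in> pts X"
    using p(3) by (auto simp: path_image_def)
  then obtain U \<phi> where chart: "(U, \<phi>) \<in> atlas X" "p (1/2) \<in> U"
    using X unfolding oriented_surface_def by blast
  then have "is_chart (pts X) U \<phi>"
    using X unfolding oriented_surface_def by blast
  then have U: "openin (top_of_set (pts X)) U" and cont_phi: "continuous_on U \<phi>"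
    and inj_phi: "inj_on \<phi> U"
    unfolding is_chart_def homeomorphism_def by (auto intro: inj_on_inverseI)
  \<comment> \<open>Restricting to the part of \<open>B\<close> sent into one chart turns
    \<open>G\<close> into a map between subsets of the plane, to which invariance of domain
    applies.\<close>
  define V where "V = B \<inter> G -` U"
  have GB: "G \<in> B \<rightarrow> pts X"
    using G_image sub(1)[OF T(1)] sub(1)[OF T(2)] p(3) by blast
  have "open V"
    using continuous_openin_preimage[OF cont_G GB U] unfolding V_def B_def
    by (metis openin_open_eq open_ball)
  moreover have cont: "continuous_on V (\<phi> \<circ> G)"
    by (rule continuous_on_compose)
      (auto simp: V_def intro: continuous_on_subset[OF cont_G] continuous_on_subset[OF cont_phi])
  moreover have "inj_on (\<phi> \<circ> G) V"
    by (rule comp_inj_on) (auto simp: V_def intro: inj_on_subset[OF inj_G] inj_on_subset[OF inj_phi])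
  ultimately have open_image: "open ((\<phi> \<circ> G) ` V)"
    using invariance_of_domain by blast
  \<comment> \<open>The open triangle together with the midpoint of its base: there
    \<open>h3\<close> is known to take values in \<open>pts X\<close>.\<close>
  define D where "D = insert (1/2) (interior model_triangle)"
  have D: "D \<subseteq> model_triangle"
    using interior_subset by (auto simp: D_def model_triangle_iff)
  define W where "W = D \<inter> h3 -` U"
  have h3X: "h3 \<in> D \<rightarrow> pts X"
    using h3(2) half(3) sub(1)[OF T(3)] \<open>p (1/2) \<in> pts X\<close> by (auto simp: D_def)
  note cont_h3 = continuous_on_subset[OF h3(1) D]
  have openW: "openin (top_of_set D) W"
    using continuous_openin_preimage[OF cont_h3 h3X U] by (simp add: W_def)
  have "continuous_on W (\<phi> \<circ> h3)"
    by (rule continuous_on_compose)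
      (auto simp: W_def intro: continuous_on_subset[OF cont_h3] continuous_on_subset[OF cont_phi])
  then have "openin (top_of_set W) (W \<inter> (\<phi> \<circ> h3) -` ((\<phi> \<circ> G) ` V))"
    by (rule continuous_openin_preimage_gen[OF _ open_image])
  then have "openin (top_of_set D) (W \<inter> (\<phi> \<circ> h3) -` ((\<phi> \<circ> G) ` V))"
    using openW openin_trans by blast
  moreover have "1/2 \<in> W \<inter> (\<phi> \<circ> h3) -` ((\<phi> \<circ> G) ` V)"
    using half chart(2) by (auto simp: W_def V_def D_def image_iff intro!: bexI[of _ "1/2"])
  ultimately obtain e where e: "e > 0"
    "ball (1/2) e \<inter> D \<subseteq> W \<inter> (\<phi> \<circ> h3) -` ((\<phi> \<circ> G) ` V)"
    unfolding openin_contains_ball by blast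
  \<comment> \<open>A point straight above the midpoint, closer to it than \<open>e\<close> and low
    enough to lie in the open triangle. Its image under \<open>h3\<close> lies in \<open>T3\<close>
    and also in the image of \<open>G\<close>, which is the contradiction.\<close>
  define z where "z = Complex (1/2) (min (e/2) (1/4))"
  have "z - 1/2 = of_real (min (e/2) (1/4)) * \<i>"
    by (simp add: z_def complex_eq_iff)
  then have "norm (z - 1/2) = \<bar>min (e/2) (1/4)\<bar>"
    by (simp only: norm_mult norm_of_real) simp
  then have "z \<in> ball (1/2) e"
    using e(1) by (simp add: dist_norm norm_minus_commute)
  moreover have z_int: "z \<in> interior model_triangle"
    using e(1) by (auto simp: interior_model_triangle_iff z_def)
  ultimately obtain v where v: "v \<in> V" "\<phi> (h3 z) = \<phi> (G v)" "h3 z \<in> U"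
    using e(2) unfolding W_def D_def by fastforce
  then have "h3 z = G v"
    using inj_phi by (auto simp: V_def inj_on_def)
  moreover have "h3 z \<in> T3"
    using h3(2) z_int by blast
  ultimately show False
    using G_image[of v] v(1) disj sub(2)[OF T(3)] by (auto simp: V_def)
qed

section \<open>Arrows and counting functions\<close>

text \<open>The contribution of the triangle \<open>T\<close> to the signed adjacency matrix of the
  quiver.\<close>

definition signed_arrows ::
  "'a::t2_space msurface \<Rightarrow> (real \<Rightarrow> 'a) set \<Rightarrow> 'a set \<Rightarrow> (real \<Rightarrow> 'a) \<Rightarrow> (real \<Rightarrow> 'a) \<Rightarrow> int" where
  "signed_arrows X \<Gamma> T p q = of_bool (arrow X \<Gamma> T p q) - of_bool (arrow X \<Gamma> T q p)"

lemma signed_arrows_skew: "signed_arrows X \<Gamma> T p q = - signed_arrows X \<Gamma> T q p"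
  by (simp add: signed_arrows_def)

lemma signed_arrows_self [simp]: "signed_arrows X \<Gamma> T p p = 0"
  by (simp add: signed_arrows_def)

lemma ccw_sides_cases:
  assumes "triangle X \<Gamma> T"
  obtains a b c where "ccw_sides X \<Gamma> T = (a, b, c)" "a \<noteq> b" "b \<noteq> c" "c \<noteq> a"
proof -
  obtain a b c where abc: "ccw_sides X \<Gamma> T = (a, b, c)"
    by (cases "ccw_sides X \<Gamma> T")
  obtain f where "triangle_map X \<Gamma> T f (a, b, c)"
    using triangle_map_ccw_sides[OF assms] abc by metis
  then show thesis
    using that[OF abc] by (auto simp: triangle_map_def)
qed

lemma arrow_sides:
  assumes "arrow X \<Gamma> T p q"
  shows "p \<in> sides X \<Gamma> T" "q \<in> sides X \<Gamma> T"
  using assms by (auto simp: arrow_def sides_def split: prod.splits)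

text \<open>The three sides are distinct, so the possible arrows in \<open>T\<close> follow an
  oriented 3-cycle, which never contains a pair and its reverse.\<close>

lemma arrow_asym:
  assumes "arrow X \<Gamma> T p q"
  shows "\<not> arrow X \<Gamma> T q p"
proof -
  have "triangle X \<Gamma> T"
    using assms by (simp add: arrow_def)
  then show ?thesis
    using assms by (elim ccw_sides_cases) (auto simp: arrow_def)
qed

lemma arrow_neq: "arrow X \<Gamma> T p q \<Longrightarrow> p \<noteq> q"
  using arrow_asym by blast

text \<open>With \<open>r\<close> internal as well, all three sides are vertices and the arrows in
  \<open>T\<close> form a full oriented 3-cycle.\<close>

lemma arrow_third_side:
  assumes "arrow X \<Gamma> T p q" "r \<in> sides X \<Gamma> T - {p, q}" "r \<in> quiver_vertices X \<Gamma>"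
  shows "arrow X \<Gamma> T q r" "arrow X \<Gamma> T r p"
proof -
  have T: "triangle X \<Gamma> T"
    using assms by (simp add: arrow_def)
  then have "arrow X \<Gamma> T q r \<and> arrow X \<Gamma> T r p"
    using assms by (elim ccw_sides_cases) (auto simp: arrow_def sides_def)
  then show "arrow X \<Gamma> T q r" "arrow X \<Gamma> T r p"
    by simp_all
qed

lemma signed_arrows_eq:
  assumes "arrow X \<Gamma> T p q"
  shows "signed_arrows X \<Gamma> T p q = 1" "signed_arrows X \<Gamma> T q p = - 1"
  using assms arrow_asym[OF assms] by (simp_all add: signed_arrows_def)

lemma signed_arrows_outside:
  assumes "p \<notin> sides X \<Gamma> T \<or> q \<notin> sides X \<Gamma> T"
  shows "signed_arrows X \<Gamma> T p q = 0"
  using assms by (auto simp: signed_arrows_def of_bool_def dest: arrow_sides)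

text \<open>Putting \<open>i\<close> into \<open>P\<close> changes the contribution from 1 to 0 for
  an arrow towards the crossed arc and from 0 to 1 for an arrow away from it; without an arrow both
  sides vanish.\<close>

lemma end_contrib_affine:
  "end_contrib X \<Gamma> w T p i P =
     end_contrib X \<Gamma> w T p i {} + (if i \<in> P then signed_arrows X \<Gamma> T (sarc w i) p else 0)"
  by (auto simp: end_contrib_def signed_arrows_def of_bool_def dest: arrow_sides arrow_asym)

section \<open>Canonical submodules as index sets\<close>

lemma zspan_support:
  fixes m :: "nat \<Rightarrow> 'k::field"
  assumes "m \<in> zspan P" "m k \<noteq> 0"
  shows "k \<in> P"
  using assms
  by (auto simp: zspan_def zvec_def split: if_splits elim!: sum.not_neutral_contains_not_neutral)

lemma zvec_in_zspan_iff:
  assumes "finite P"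
  shows "(zvec i :: nat \<Rightarrow> 'k::field) \<in> zspan P \<longleftrightarrow> i \<in> P"
proof
  assume "(zvec i :: nat \<Rightarrow> 'k) \<in> zspan P"
  then show "i \<in> P"
    by (rule zspan_support) (simp add: zvec_def)
next
  assume "i \<in> P"
  then have "zvec i = (\<lambda>k. \<Sum>l\<in>P. of_bool (l = i) * (zvec l k :: 'k))"
    using assms by (auto simp: of_bool_def if_distrib[of "\<lambda>x. x * _"] cong: if_cong)
  then show "(zvec i :: nat \<Rightarrow> 'k) \<in> zspan P"
    unfolding zspan_def by (intro CollectI exI)
qed

text \<open>What stability under the arrow of each letter means for the index set; the field no
  longer occurs.\<close>

definition closed_set :: "'a string_data \<Rightarrow> nat set \<Rightarrow> bool" where
  "closed_set w P \<longleftrightarrow> P \<subseteq> {1..slen w} \<and>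
     (\<forall>i \<in> {1..<slen w}. if sdirect w i then i \<in> P \<longrightarrow> i + 1 \<in> P else i + 1 \<in> P \<longrightarrow> i \<in> P)"

lemma closed_set_letter:
  assumes "closed_set w P" "i \<in> {1..<slen w}"
  shows "sdirect w i \<Longrightarrow> i \<in> P \<longrightarrow> i + 1 \<in> P"
    and "\<not> sdirect w i \<Longrightarrow> i + 1 \<in> P \<longrightarrow> i \<in> P"
  using bspec[OF conjunct2[OF assms(1)[unfolded closed_set_def]] assms(2)] by simp_all

text \<open>
  The summands of \<^const>\<open>ncount\<close> regrouped by the triangles \<open>\<Delta>\<^sub>0, ..., \<Delta>\<^sub>s\<close> in which they arise.
\<close>

definition third_side_count ::
  "'a::t2_space msurface \<Rightarrow> (real \<Rightarrow> 'a) set \<Rightarrow> 'a string_data \<Rightarrow>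
   (real \<Rightarrow> 'a) \<Rightarrow> nat \<Rightarrow> nat set \<Rightarrow> int" where
  "third_side_count X \<Gamma> w p i P =
     (if i < slen w \<and> p \<in> sides X \<Gamma> (stri w i) - {sarc w i, sarc w (i + 1)}
      then of_bool ((i \<in> P) \<noteq> (i + 1 \<in> P)) else 0)"

text \<open>Inside the triangle with index \<open>i\<close> meet \<open>nplus\<close> of crossing
  \<open>i\<close> and \<open>nminus\<close> of crossing \<open>i + 1\<close>. In the first and the
  last triangle one of these crossings is missing and the end contribution takes its place.\<close>

definition triangle_count ::
  "'a::t2_space msurface \<Rightarrow> (real \<Rightarrow> 'a) set \<Rightarrow> 'a string_data \<Rightarrow>
   (real \<Rightarrow> 'a) \<Rightarrow> nat \<Rightarrow> nat set \<Rightarrow> int" where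
  "triangle_count X \<Gamma> w p i P =
     (if 1 \<le> i then of_bool (sarc w i = p) * nplus w i P + third_side_count X \<Gamma> w p i P
      else end_contrib X \<Gamma> w (stri w 0) p 1 P) +
     (if i < slen w then of_bool (sarc w (i + 1) = p) * nminus w (i + 1) P
      else end_contrib X \<Gamma> w (stri w (slen w)) p (slen w) P)"

text \<open>Once the triangles on the two sides of crossing \<open>k\<close> are known to be the
  only ones with side \<open>sarc w k\<close>, this is an entry of the signed adjacency matrix of
  the quiver.\<close>

definition crossing_arrows ::
  "'a::t2_space msurface \<Rightarrow> (real \<Rightarrow> 'a) set \<Rightarrow> 'a string_data \<Rightarrow> nat \<Rightarrow> (real \<Rightarrow> 'a) \<Rightarrow> int" where
  "crossing_arrows X \<Gamma> w k p =
     signed_arrows X \<Gamma> (stri w (k - 1)) (sarc w k) p + signed_arrows X \<Gamma> (stri w k) (sarc w k) p"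

lemma ncount_eq:
  "ncount X \<Gamma> w p i P =
     of_bool (sarc w i = p) * nplus w i P + of_bool (sarc w i = p) * nminus w i P +
     third_side_count X \<Gamma> w p i P +
     (if i = 1 then end_contrib X \<Gamma> w (stri w 0) p i P else 0) +
     (if i = slen w then end_contrib X \<Gamma> w (stri w (slen w)) p i P else 0)"
  by (simp add: ncount_def third_side_count_def)

section \<open>Counts along the string of a fixed arc\<close>

context
  fixes X :: "'a::t2_space msurface" and \<Gamma> \<gamma> w
  assumes w: "string_of X \<Gamma> \<gamma> w"
begin

lemma slen_pos: "1 \<le> slen w"
  using w by (simp add: string_of_def)

lemma sarc_vertex: "i \<in> {1..slen w} \<Longrightarrow> sarc w i \<in> quiver_vertices X \<Gamma>"
  using w by (simp add: string_of_def)

lemma stri_triangle: "i \<le> slen w \<Longrightarrow> triangle X \<Gamma> (stri w i)"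
  using w by (simp add: string_of_def)

lemma crossing_sides:
  assumes "i \<in> {1..slen w}"
  shows "stri w (i - 1) \<noteq> stri w i" "sarc w i \<in> sides X \<Gamma> (stri w (i - 1))"
    "sarc w i \<in> sides X \<Gamma> (stri w i)"
  using w assms unfolding string_of_def by blast+

lemma letter_arrows:
  assumes "i \<in> {1..<slen w}"
  shows "sdirect w i \<Longrightarrow> arrow X \<Gamma> (stri w i) (sarc w i) (sarc w (i + 1))"
    and "\<not> sdirect w i \<Longrightarrow> arrow X \<Gamma> (stri w i) (sarc w (i + 1)) (sarc w i)"
  using w assms unfolding string_of_def by blast+

text \<open>
  If a letter goes from \<open>x\<^sub>i\<close> to \<open>x\<^sub>i\<^sub>+\<^sub>1\<close>, then a submodule containing \<open>z\<^sub>i\<close> contains \<open>z\<^sub>i\<^sub>+\<^sub>1\<close>, so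
  that contribution (B), which is not affine on arbitrary sets P, is the difference of two
  indicators here.
\<close>

lemma triangle_count_affine:
  assumes P: "closed_set w P" and i: "i \<le> slen w" and p: "p \<in> quiver_vertices X \<Gamma>"
  shows "triangle_count X \<Gamma> w p i P = triangle_count X \<Gamma> w p i {} +
    (if i \<in> P then signed_arrows X \<Gamma> (stri w i) (sarc w i) p else 0) +
    (if i + 1 \<in> P then signed_arrows X \<Gamma> (stri w i) (sarc w (i + 1)) p else 0)"
proof -
  \<comment> \<open>0 and \<open>slen w + 1\<close> are no crossings, so in each end triangle one of
    the two indicator terms drops out.\<close>
  have bounds: "0 \<notin> P" "slen w + 1 \<notin> P"
    using P by (auto simp: closed_set_def)
  consider "i = 0" | "i = slen w" "1 \<le> i" | "1 \<le> i" "i < slen w"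
    using i by linarith
  then show ?thesis
  proof cases
    case 1
    then show ?thesis
      using slen_pos bounds end_contrib_affine[of X \<Gamma> w "stri w 0" p 1 P]
      by (simp add: triangle_count_def nminus_def)
  next
    case 2
    then show ?thesis
      using bounds end_contrib_affine[of X \<Gamma> w "stri w i" p i P]
      by (simp add: triangle_count_def nplus_def third_side_count_def)
  next
    case 3
    let ?T = "stri w i"
    let ?a = "sarc w i" and ?b = "sarc w (i + 1)"
    consider (outside) "p \<notin> sides X \<Gamma> ?T" "p \<noteq> ?a" "p \<noteq> ?b" | (source) "p = ?a" | (target) "p = ?b"
      | (third) "p \<in> sides X \<Gamma> ?T - {?a, ?b}"
      by blast
    note cases = this
    show ?thesis
    proof (cases "sdirect w i")
      case True
      have ar: "arrow X \<Gamma> ?T ?a ?b" and cl: "i \<in> P \<longrightarrow> i + 1 \<in> P"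
        using letter_arrows(1)[of i] closed_set_letter(1)[OF P, of i] 3 True by simp_all
      show ?thesis
        using cases
      proof cases
        case outside
        then show ?thesis
          using 3 signed_arrows_outside[of _ X \<Gamma> ?T p]
          by (simp add: triangle_count_def third_side_count_def)
      next
        \<comment> \<open>Here \<open>?a\<close>, \<open>?b\<close>, \<open>p\<close> form an
          oriented 3-cycle, so the coefficients of the indicators of \<open>i\<close> and
          \<open>i + 1\<close> are -1 and 1.\<close>
        case third
        then show ?thesis
          using 3 cl True signed_arrows_eq[OF arrow_third_side(1)[OF ar third p]]
            signed_arrows_eq[OF arrow_third_side(2)[OF ar third p]]
          by (auto simp: triangle_count_def third_side_count_def)
      qed (use 3 cl True arrow_neq[OF ar] signed_arrows_eq[OF ar] in
          \<open>auto simp: triangle_count_def third_side_count_def nplus_def nminus_def\<close>)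
    next
      case False
      have ar: "arrow X \<Gamma> ?T ?b ?a" and cl: "i + 1 \<in> P \<longrightarrow> i \<in> P"
        using letter_arrows(2)[of i] closed_set_letter(2)[OF P, of i] 3 False by simp_all
      show ?thesis
        using cases
      proof cases
        case outside
        then show ?thesis
          using 3 signed_arrows_outside[of _ X \<Gamma> ?T p]
          by (simp add: triangle_count_def third_side_count_def)
      next
        case third
        then have third': "p \<in> sides X \<Gamma> ?T - {?b, ?a}"
          by blast
        then show ?thesis
          using 3 cl False signed_arrows_eq[OF arrow_third_side(1)[OF ar third' p]]
            signed_arrows_eq[OF arrow_third_side(2)[OF ar third' p]]
          by (auto simp: triangle_count_def third_side_count_def)
      qed (use 3 cl False arrow_neq[OF ar] signed_arrows_eq[OF ar] in
          \<open>auto simp: triangle_count_def third_side_count_def nplus_def nminus_def\<close>)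
    qed
  qed
qed

text \<open>Allows the lone \<open>nplus\<close> term at \<open>j\<close> in \<open>Nplus\<close> to
  be completed to the count of a whole triangle.\<close>

lemma third_side_count_crossed:
  "third_side_count X \<Gamma> w (sarc w j) j P = 0"
  by (simp add: third_side_count_def)

text \<open>The count at crossing \<open>i\<close> splits between the triangles before and after it;
  collecting by triangles gives exactly those after crossing \<open>j\<close>, the first one being
  entered through \<open>nplus\<close> at \<open>j\<close>.\<close>

lemma Nplus_eq:
  assumes j: "j \<in> {1..slen w}"
  shows "Nplus X \<Gamma> w j P = (\<Sum>i\<in>{j..slen w}. triangle_count X \<Gamma> w (sarc w j) i P)"
proof -
  let ?p = "sarc w j" and ?n = "slen w"
  define A where "A i = of_bool (sarc w i = ?p) * nplus w i P + third_side_count X \<Gamma> w ?p i P" for i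
  define C where "C i = of_bool (sarc w i = ?p) * nminus w i P" for i
  define D where "D = end_contrib X \<Gamma> w (stri w ?n) ?p ?n P"
  have "Nplus X \<Gamma> w j P = A j + (\<Sum>i\<in>{j<..?n}. A i + C i + (if i = ?n then D else 0))"
    unfolding Nplus_def using j
    by (intro arg_cong2[of _ _ _ _ "(+)"] sum.cong)
      (auto simp: A_def C_def D_def ncount_eq third_side_count_crossed)
  also have "\<dots> = (A j + (\<Sum>i\<in>{j<..?n}. A i)) + (\<Sum>i\<in>{j<..?n}. C i) + (\<Sum>i\<in>{j<..?n}. if i = ?n then D else 0)"
    by (simp add: sum.distrib)
  also have "(\<Sum>i\<in>{j<..?n}. if i = ?n then D else 0) = D"
  proof (cases "j = ?n")
    \<comment> \<open>The sum is empty, and \<open>D\<close> vanishes because an arc receives no end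
      contribution from its own crossing.\<close>
    case True
    then show ?thesis
      by (simp add: D_def end_contrib_def)
  qed (use j in simp)
  also have "A j + (\<Sum>i\<in>{j<..?n}. A i) = (\<Sum>i\<in>{j..?n}. A i)"
    using j by (simp add: sum.head)
  \<comment> \<open>\<open>nminus\<close> at crossing \<open>i\<close> belongs to the preceding
    triangle, hence the shift by one.\<close>
  also have "(\<Sum>i\<in>{j<..?n}. C i) = (\<Sum>i\<in>{j..<?n}. C (i + 1))"
    by (simp add: atLeastSucAtMost_greaterThanAtMost[symmetric] atLeastLessThanSuc_atLeastAtMost[symmetric]
        sum.shift_bounds_Suc_ivl del: sum.op_ivl_Suc)
  also have "(\<Sum>i\<in>{j..?n}. A i) + (\<Sum>i\<in>{j..<?n}. C (i + 1)) + D =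
      (\<Sum>i\<in>{j..?n}. A i + (if i < ?n then C (i + 1) else D))"
  proof -
    have "{j..?n} = insert ?n {j..<?n}"
      using j by auto
    then show ?thesis
      by (simp add: sum.distrib)
  qed
  also have "\<dots> = (\<Sum>i\<in>{j..?n}. triangle_count X \<Gamma> w ?p i P)"
    using j by (intro sum.cong) (auto simp: triangle_count_def A_def C_def D_def)
  finally show ?thesis .
qed

text \<open>The mirror image of \<open>Nplus_eq\<close>: \<open>nminus\<close> at \<open>j\<close>
  completes the triangle just before crossing \<open>j\<close>.\<close>

lemma Nminus_eq:
  assumes j: "j \<in> {1..slen w}"
  shows "Nminus X \<Gamma> w j P = (\<Sum>i\<in>{0..<j}. triangle_count X \<Gamma> w (sarc w j) i P)"
proof -
  let ?p = "sarc w j"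
  define A where "A i = of_bool (sarc w i = ?p) * nplus w i P + third_side_count X \<Gamma> w ?p i P" for i
  define C where "C i = of_bool (sarc w i = ?p) * nminus w i P" for i
  define D where "D = end_contrib X \<Gamma> w (stri w 0) ?p 1 P"
  have "Nminus X \<Gamma> w j P = C j + (\<Sum>i\<in>{1..<j}. A i + C i + (if i = 1 then D else 0))"
    unfolding Nminus_def using j
    by (intro arg_cong2[of _ _ _ _ "(+)"] sum.cong) (auto simp: A_def C_def D_def ncount_eq)
  also have "\<dots> = (\<Sum>i\<in>{1..<j}. A i) + (C j + (\<Sum>i\<in>{1..<j}. C i)) + (\<Sum>i\<in>{1..<j}. if i = 1 then D else 0)"
    by (simp add: sum.distrib)
  also have "(\<Sum>i\<in>{1..<j}. if i = 1 then D else 0) = D"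
  proof (cases "j = 1")
    case True
    then show ?thesis
      by (simp add: D_def end_contrib_def)
  qed (use j in simp)
  also have "C j + (\<Sum>i\<in>{1..<j}. C i) = (\<Sum>i\<in>{1..<Suc j}. C i)"
    using j by (simp add: add.commute)
  also have "\<dots> = (\<Sum>i\<in>{0..<j}. C (i + 1))"
    using sum.shift_bounds_Suc_ivl[of C 0 j] by simp
  also have "(\<Sum>i\<in>{1..<j}. A i) + (\<Sum>i\<in>{0..<j}. C (i + 1)) + D =
      (\<Sum>i\<in>{0..<j}. (if 1 \<le> i then A i else D) + C (i + 1))"
  proof -
    have "{0..<j} = insert 0 {1..<j}"
      using j by auto
    then show ?thesis
      by (simp add: sum.distrib)
  qed
  also have "\<dots> = (\<Sum>i\<in>{0..<j}. triangle_count X \<Gamma> w ?p i P)"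
    using j by (intro sum.cong) (auto simp: triangle_count_def A_def C_def D_def)
  finally show ?thesis .
qed

section \<open>Affine dependence on the submodule\<close>

text \<open>For \<open>k > j\<close> both triangles at crossing \<open>k\<close> come after crossing
  \<open>j\<close>, so each such \<open>k\<close> in \<open>P\<close> brings both summands of
  \<open>crossing_arrows\<close>.\<close>

lemma Nplus_affine:
  assumes P: "closed_set w P" and j: "j \<in> {1..slen w}"
  shows "Nplus X \<Gamma> w j P = Nplus X \<Gamma> w j {} +
    (\<Sum>k\<in>{k\<in>P. j < k}. crossing_arrows X \<Gamma> w k (sarc w j))"
proof -
  let ?p = "sarc w j" and ?n = "slen w"
  \<comment> \<open>\<open>R k\<close> and \<open>L k\<close> are the effects of crossing
    \<open>k\<close> on the triangles after and before it.\<close>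
  define R where "R k = (if k \<in> P then signed_arrows X \<Gamma> (stri w k) (sarc w k) ?p else 0)" for k
  define L where "L k = (if k \<in> P then signed_arrows X \<Gamma> (stri w (k - 1)) (sarc w k) ?p else 0)" for k
  have PP: "P \<subseteq> {1..?n}"
    using P by (simp add: closed_set_def)
  have "Nplus X \<Gamma> w j P = (\<Sum>i\<in>{j..?n}. triangle_count X \<Gamma> w ?p i {} + (R i + L (i + 1)))"
    unfolding Nplus_eq[OF j]
    by (intro sum.cong) (use triangle_count_affine[OF P _ sarc_vertex[OF j]] in \<open>auto simp: R_def L_def\<close>)
  also have "\<dots> = Nplus X \<Gamma> w j {} + ((\<Sum>i\<in>{j..?n}. R i) + (\<Sum>i\<in>{j..?n}. L (i + 1)))"
    by (simp add: Nplus_eq[OF j] sum.distrib)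
  \<comment> \<open>Crossing \<open>j\<close> itself drops out: the signed number of arrows from an
    arc to itself is 0.\<close>
  also have "(\<Sum>i\<in>{j..?n}. R i) = (\<Sum>i\<in>{j<..?n}. R i)"
    using j by (simp add: sum.head R_def)
  also have "(\<Sum>i\<in>{j..?n}. L (i + 1)) = (\<Sum>i\<in>{j<..Suc ?n}. L i)"
    using sum.shift_bounds_cl_Suc_ivl[of L j ?n]
    by (simp add: atLeastSucAtMost_greaterThanAtMost)
  also have "\<dots> = (\<Sum>i\<in>{j<..?n}. L i)"
    using PP by (intro sum.mono_neutral_right) (auto simp: L_def)
  also have "(\<Sum>i\<in>{j<..?n}. R i) + (\<Sum>i\<in>{j<..?n}. L i) =
      (\<Sum>k\<in>{j<..?n}. if k \<in> P then crossing_arrows X \<Gamma> w k ?p else 0)"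
    unfolding sum.distrib[symmetric] by (intro sum.cong) (auto simp: R_def L_def crossing_arrows_def)
  also have "\<dots> = (\<Sum>k\<in>{k\<in>P. j < k}. crossing_arrows X \<Gamma> w k ?p)"
    using PP by (intro sum.mono_neutral_cong_right) auto
  finally show ?thesis .
qed

text \<open>For \<open>k < j\<close> both triangles at crossing \<open>k\<close> come before
  crossing \<open>j\<close>. The boundary terms \<open>R 0\<close> and \<open>L j\<close> vanish, as
  0 is not in \<open>P\<close> and an arc has no signed arrows to itself.\<close>

lemma Nminus_affine:
  assumes P: "closed_set w P" and j: "j \<in> {1..slen w}"
  shows "Nminus X \<Gamma> w j P = Nminus X \<Gamma> w j {} +
    (\<Sum>k\<in>{k\<in>P. k < j}. crossing_arrows X \<Gamma> w k (sarc w j))"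
proof -
  let ?p = "sarc w j" and ?n = "slen w"
  define R where "R k = (if k \<in> P then signed_arrows X \<Gamma> (stri w k) (sarc w k) ?p else 0)" for k
  define L where "L k = (if k \<in> P then signed_arrows X \<Gamma> (stri w (k - 1)) (sarc w k) ?p else 0)" for k
  have PP: "P \<subseteq> {1..?n}"
    using P by (simp add: closed_set_def)
  have "Nminus X \<Gamma> w j P = (\<Sum>i\<in>{0..<j}. triangle_count X \<Gamma> w ?p i {} + (R i + L (i + 1)))"
    unfolding Nminus_eq[OF j]
    by (intro sum.cong) (use j triangle_count_affine[OF P _ sarc_vertex[OF j]] in \<open>auto simp: R_def L_def\<close>)
  also have "\<dots> = Nminus X \<Gamma> w j {} + ((\<Sum>i\<in>{0..<j}. R i) + (\<Sum>i\<in>{0..<j}. L (i + 1)))"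
    by (simp add: Nminus_eq[OF j] sum.distrib)
  also have "(\<Sum>i\<in>{0..<j}. R i) = (\<Sum>i\<in>{1..<j}. R i)"
    using PP by (intro sum.mono_neutral_right) (auto simp: R_def)
  also have "(\<Sum>i\<in>{0..<j}. L (i + 1)) = (\<Sum>i\<in>{1..<Suc j}. L i)"
    using sum.shift_bounds_Suc_ivl[of L 0 j] by simp
  also have "\<dots> = (\<Sum>i\<in>{1..<j}. L i)"
    using j by (simp add: L_def)
  also have "(\<Sum>i\<in>{1..<j}. R i) + (\<Sum>i\<in>{1..<j}. L i) =
      (\<Sum>k\<in>{1..<j}. if k \<in> P then crossing_arrows X \<Gamma> w k ?p else 0)"
    unfolding sum.distrib[symmetric] by (intro sum.cong) (auto simp: R_def L_def crossing_arrows_def)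
  also have "\<dots> = (\<Sum>k\<in>{k\<in>P. k < j}. crossing_arrows X \<Gamma> w k ?p)"
    using PP by (intro sum.mono_neutral_cong_right) auto
  finally show ?thesis .
qed

text \<open>The sign records whether crossing \<open>k\<close> enters through \<open>Nplus\<close>
  or, negatively, through \<open>Nminus\<close>.\<close>

definition interaction :: "nat \<Rightarrow> nat \<Rightarrow> int" where
  "interaction j k = sgn (int k - int j) * crossing_arrows X \<Gamma> w k (sarc w j)"

text \<open>\<open>Mplus\<close> and \<open>Mminus\<close> do not depend on \<open>P\<close>. The
  constant term has a minus sign because \<open>j\<close> is not in the empty set, where
  \<open>Omega'\<close> is the negated difference.\<close>

lemma Omega'_affine:
  assumes P: "closed_set w P" and j: "j \<in> P"
  shows "Omega' X \<Gamma> w j P = - Omega' X \<Gamma> w j {} + (\<Sum>k\<in>P - {j}. interaction j k)"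
proof -
  have PP: "P \<subseteq> {1..slen w}"
    using P by (simp add: closed_set_def)
  then have jn: "j \<in> {1..slen w}" and fin: "finite P"
    using j finite_subset by auto
  have "(\<Sum>k\<in>P - {j}. interaction j k) =
      (\<Sum>k\<in>{k\<in>P. j < k} \<union> {k\<in>P. k < j}. interaction j k)"
    by (intro sum.cong) auto
  also have "\<dots> = (\<Sum>k\<in>{k\<in>P. j < k}. interaction j k) + (\<Sum>k\<in>{k\<in>P. k < j}. interaction j k)"
    using fin by (intro sum.union_disjoint) auto
  also have "\<dots> = (\<Sum>k\<in>{k\<in>P. j < k}. crossing_arrows X \<Gamma> w k (sarc w j)) -
      (\<Sum>k\<in>{k\<in>P. k < j}. crossing_arrows X \<Gamma> w k (sarc w j))"
    by (simp add: interaction_def sum_negf[symmetric])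
  finally show ?thesis
    using j by (simp add: Omega'_def Let_def Nplus_affine[OF P jn] Nminus_affine[OF P jn])
qed

text \<open>
  An arrow between \<open>x\<^sub>j\<close> and \<open>x\<^sub>k\<close> can only lie in a triangle that is adjacent to both crossings, as each
  of the two arcs is a side of no further triangle.
\<close>

lemma crossing_arrows_skew:
  assumes X: "oriented_surface X" and \<Gamma>: "marked_triangulation X \<Gamma>"
    and jk: "j \<in> {1..slen w}" "k \<in> {1..slen w}"
  shows "crossing_arrows X \<Gamma> w k (sarc w j) = - crossing_arrows X \<Gamma> w j (sarc w k)"
proof -
  \<comment> \<open>The two triangles at a crossing are distinct, so summing over this set counts
    both.\<close>
  define D where "D i = {stri w (i - 1), stri w i}" for i
  have sum_D: "crossing_arrows X \<Gamma> w i p = (\<Sum>T\<in>D i. signed_arrows X \<Gamma> T (sarc w i) p)"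
    if "i \<in> {1..slen w}" for i p
    using crossing_sides(1)[OF that] by (simp add: crossing_arrows_def D_def)
  have tri: "triangle X \<Gamma> T" if "T \<in> D i" "i \<in> {1..slen w}" for T i
    using that stri_triangle by (auto simp: D_def)
  have only: "T \<in> D i" if i: "i \<in> {1..slen w}" and T: "triangle X \<Gamma> T" "sarc w i \<in> sides X \<Gamma> T" for T i
  proof -
    have "sarc w i \<in> \<Gamma>"
      using sarc_vertex[OF i] by (simp add: quiver_vertices_def)
    moreover from this have "marked_arc X (sarc w i)"
      using \<Gamma> by (simp add: marked_triangulation_def)
    moreover have "triangle X \<Gamma> (stri w (i - 1))" "triangle X \<Gamma> (stri w i)"
      using i by (auto intro: stri_triangle)
    ultimately have "T = stri w (i - 1) \<or> T = stri w i"
      using at_most_two_triangles[OF X] crossing_sides[OF i] T by (simp add: marked_arc_def)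
    then show ?thesis
      by (simp add: D_def)
  qed
  have restrict: "crossing_arrows X \<Gamma> w i (sarc w i') =
      (\<Sum>T\<in>D i \<inter> D i'. signed_arrows X \<Gamma> T (sarc w i) (sarc w i'))"
    if ii: "i \<in> {1..slen w}" "i' \<in> {1..slen w}" for i i'
    unfolding sum_D[OF ii(1)]
  proof (rule sum.mono_neutral_right)
    show "\<forall>T\<in>D i - D i \<inter> D i'. signed_arrows X \<Gamma> T (sarc w i) (sarc w i') = 0"
      using only[OF ii(2)] tri[OF _ ii(1)] signed_arrows_outside by blast
  qed (auto simp: D_def)
  \<comment> \<open>Both sums now run over the same triangles and are opposite term by term.\<close>
  show ?thesis
    unfolding restrict[OF jk] restrict[OF jk(2,1)] Int_commute[of "D k"] sum_negf[symmetric]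
    by (intro sum.cong refl signed_arrows_skew)
qed

text \<open>Both factors of \<open>interaction\<close> change sign when \<open>j\<close> and
  \<open>k\<close> are exchanged.\<close>

lemma interaction_sym:
  assumes "oriented_surface X" "marked_triangulation X \<Gamma>"
    and "j \<in> {1..slen w}" "k \<in> {1..slen w}"
  shows "interaction j k = interaction k j"
  using crossing_arrows_skew[OF assms] by (simp add: interaction_def sgn_if)

text \<open>Applying the arrow of a letter to the basis vector at its source gives an element of
  \<open>N\<close> with nonzero coordinate at its target.\<close>

lemma submodule_closed_set:
  fixes N :: "(nat \<Rightarrow> 'k::field) set"
  assumes "submodule X \<Gamma> w N" and N: "N = zspan P" and P: "P \<subseteq> {1..slen w}"
  shows "closed_set w P"
proof -
  have fin: "finite P"
    using P finite_subset by blast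
  have zvec: "zvec i \<in> N" if "i \<in> P" for i
    using that fin by (simp add: N zvec_in_zspan_iff)
  have support: "k \<in> P" if "m \<in> N" "m k \<noteq> 0" for m k
    using that by (simp add: N zspan_support)
  have letter: "letter_arrow w i \<in> quiver_arrows X \<Gamma>" if "i \<in> {1..<slen w}" for i
    using letter_arrows[OF that] by (simp add: letter_arrow_def quiver_arrows_def)
  have act: "arrow_act w (letter_arrow w i) m \<in> N" if "i \<in> {1..<slen w}" "m \<in> N" for i m
    using assms(1) letter[OF that(1)] that(2) by (simp add: submodule_def)
  have "i + 1 \<in> P" if i: "i \<in> {1..<slen w}" "sdirect w i" "i \<in> P" for i
  proof (rule support[OF act[OF i(1) zvec[OF i(3)]]])
    \<comment> \<open>The same arrow may underlie several letters; in coordinate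
      \<open>i + 1\<close> only the letter \<open>i\<close> contributes.\<close>
    have "arrow_act w (letter_arrow w i) (zvec i :: nat \<Rightarrow> 'k) (i + 1) =
        (\<Sum>l\<in>{l \<in> {1..<slen w}. letter_arrow w l = letter_arrow w i}. if l = i then 1 else 0)"
      unfolding arrow_act_def using i(2) by (intro sum.cong) (auto simp: zvec_def)
    then show "arrow_act w (letter_arrow w i) (zvec i :: nat \<Rightarrow> 'k) (i + 1) \<noteq> 0"
      using i(1) by (simp add: sum.delta)
  qed
  moreover have "i \<in> P" if i: "i \<in> {1..<slen w}" "\<not> sdirect w i" "i + 1 \<in> P" for i
  proof (rule support[OF act[OF i(1) zvec[OF i(3)]]])
    have "arrow_act w (letter_arrow w i) (zvec (i + 1) :: nat \<Rightarrow> 'k) i =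
        (\<Sum>l\<in>{l \<in> {1..<slen w}. letter_arrow w l = letter_arrow w i}. if l = i then 1 else 0)"
      unfolding arrow_act_def using i(2) by (intro sum.cong) (auto simp: zvec_def)
    then show "arrow_act w (letter_arrow w i) (zvec (i + 1) :: nat \<Rightarrow> 'k) i \<noteq> 0"
      using i(1) by (simp add: sum.delta)
  qed
  ultimately show ?thesis
    using P by (simp add: closed_set_def)
qed

lemma canonical_submodule_closed_set:
  fixes N :: "(nat \<Rightarrow> 'k::field) set"
  assumes "N \<in> canonical_submodules X \<Gamma> w"
  shows "closed_set w (index_set w N)"
proof -
  obtain P where P: "submodule X \<Gamma> w N" "P \<subseteq> {1..slen w}" "N = zspan P"
    using assms by (auto simp: canonical_submodules_def)
  have fin: "finite P"
    using P(2) finite_subset by blast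
  have "index_set w N = P"
    using P(2) fin by (auto simp: index_set_def P(3) zvec_in_zspan_iff)
  then show ?thesis
    using submodule_closed_set[OF P(1,3,2)] by simp
qed

end

section \<open>The potential\<close>

text \<open>\<open>V\<close> adds \<alpha> over the elements and \<beta> over the unordered pairs of
  \<open>P\<close>, each pair once with the larger index first. A new \<open>j\<close> creates the
  pairs of \<open>j\<close> with the elements of \<open>P\<close>; symmetry rewrites those in which
  \<open>j\<close> is the smaller index.\<close>

lemma quadratic_potential:
  fixes \<alpha> :: "nat \<Rightarrow> int" and \<beta> :: "nat \<Rightarrow> nat \<Rightarrow> int"
  defines "V \<equiv> \<lambda>P. (\<Sum>i\<in>P. \<alpha> i + (\<Sum>k\<in>P. if k < i then \<beta> i k else 0))"
  assumes fin: "finite P" and j: "j \<notin> P" and sym: "\<And>i. i \<in> P \<Longrightarrow> \<beta> i j = \<beta> j i"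
  shows "V (insert j P) - V P = \<alpha> j + (\<Sum>k\<in>P. \<beta> j k)"
proof -
  have "V (insert j P) - V P = \<alpha> j + ((\<Sum>k\<in>P. if k < j then \<beta> j k else 0) + (\<Sum>i\<in>P. if j < i then \<beta> i j else 0))"
    using fin j by (simp add: V_def sum.distrib)
  also have "(\<Sum>k\<in>P. if k < j then \<beta> j k else 0) + (\<Sum>i\<in>P. if j < i then \<beta> i j else 0) = (\<Sum>k\<in>P. \<beta> j k)"
    unfolding sum.distrib[symmetric] using sym j by (intro sum.cong) (auto simp: not_less le_less)
  finally show ?thesis .
qed

theorem theorem1p1:
  fixes X :: "'a::t2_space msurface"
    and \<Gamma> :: "(real \<Rightarrow> 'a) set"
    and \<gamma> :: "real \<Rightarrow> 'a"
    and w :: "'a string_data"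
  assumes "marked_surface X"
    and "marked_triangulation X \<Gamma>"
    and "internal_arc X \<gamma>"
    and "\<not> (\<exists>p \<in> \<Gamma>. same_arc X p \<gamma>)"
    and "string_of X \<Gamma> \<gamma> w"
  shows "\<exists>v :: (nat \<Rightarrow> 'k::alg_closed_field) set \<Rightarrow> int.
           v {\<lambda>_. 0} = 0 \<and>
           (\<forall>N \<in> canonical_submodules X \<Gamma> w. \<forall>N' \<in> canonical_submodules X \<Gamma> w. \<forall>j.
              j \<notin> index_set w N' \<and> index_set w N = insert j (index_set w N') \<longrightarrow>
              v N - v N' = Omega' X \<Gamma> w j (index_set w N))"
proof -
  note w = assms(5)
  have X: "oriented_surface X"
    using assms(1) by (simp add: marked_surface_def)
  \<comment> \<open>The constant term of \<open>Omega'_affine\<close>.\<close>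
  define \<alpha> where "\<alpha> j = - Omega' X \<Gamma> w j {}" for j
  define \<beta> where "\<beta> = interaction X \<Gamma> w"
  define V where "V P = (\<Sum>i\<in>P. \<alpha> i + (\<Sum>k\<in>P. if k < i then \<beta> i k else 0))" for P
  define v where "v N = V (index_set w N)" for N :: "(nat \<Rightarrow> 'k) set"
  show ?thesis
  proof (intro exI[of _ v] conjI ballI allI impI)
    have "index_set w {\<lambda>_. 0 :: 'k} = {}"
      by (auto simp: index_set_def zvec_def fun_eq_iff)
    then show "v {\<lambda>_. 0} = 0"
      by (simp add: v_def V_def)
  next
    fix N N' :: "(nat \<Rightarrow> 'k) set" and j
    assume N: "N \<in> canonical_submodules X \<Gamma> w" "N' \<in> canonical_submodules X \<Gamma> w"
    assume "j \<notin> index_set w N' \<and> index_set w N = insert j (index_set w N')"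
    then have j: "j \<notin> index_set w N'" and eq: "index_set w N = insert j (index_set w N')"
      by simp_all
    have sub: "index_set w N \<subseteq> {1..slen w}"
      by (auto simp: index_set_def)
    have "v N - v N' = \<alpha> j + (\<Sum>k\<in>index_set w N'. \<beta> j k)"
      unfolding v_def eq V_def
    proof (rule quadratic_potential[OF _ j])
      show "finite (index_set w N')"
        by (simp add: index_set_def)
      show "\<beta> i j = \<beta> j i" if "i \<in> index_set w N'" for i
        unfolding \<beta>_def using that sub eq
        by (intro interaction_sym[OF w X assms(2)]) auto
    qed
    \<comment> \<open>The affine formula is applied to the larger submodule \<open>N\<close>; its
      indices other than \<open>j\<close> are those of \<open>N'\<close>.\<close>
    also have "\<dots> = Omega' X \<Gamma> w j (index_set w N)"
      using Omega'_affine[OF w canonical_submodule_closed_set[OF w N(1)], of j] j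
      by (simp add: eq \<alpha>_def \<beta>_def)
    finally show "v N - v N' = Omega' X \<Gamma> w j (index_set w N)" .
  qed
qed
end
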